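(* Let $G$ be a topological group, $V$ a Banach space, $\alpha\colon G\to\mathrm{Iso}(V)$ a strongly continuous representation, $\mathcal{A}:=\overline{\mathrm{Span}}\,\alpha(G)\le L(V)$, and let $x\in V$, $\phi\in V^{*}$. If the functional $\Phi_{x,\phi}\in\mathcal{A}^{*}$ is left Asplund (resp. left tame) in $\mathcal{A}^{*}$, then the function $f_{x,\phi}\colon G\to\mathbb{R}$ is right Asplund (resp. right tame) in $\mathrm{RUC}_{b}(G)$.
   Context: All vector spaces are over $\mathbb{R}$; $B_{W}$ is the closed unit ball of a Banach space $W$. A strongly continuous representation of $G$ on $V$ is a strongly continuous co-homomorphism $\alpha$ (i.e. $\alpha(gh)=\alpha(h)\alpha(g)$) from $G$ to the group $\mathrm{Iso}(V)$ of linear isometries of $V$; write $x\cdot g=\alpha(g)(x)$. $\overline{\mathrm{Span}}$ is the norm-closed linear span in the algebra $L(V)$ of bounded operators, a Banach algebra under composition. Matrix coefficients: $\Phi_{x,\phi}\in\mathcal{A}^{*}$, $\langle\Phi_{x,\phi},b\rangle:=\langle\phi,bx\rangle$, and $f_{x,\phi}(g):=\langle\Phi_{x,\phi},\alpha(g)\rangle=\langle\phi,x\cdot g\rangle$. $\mathrm{RUC}_{b}(G)$ is the Banach space (sup norm) of bounded right uniformly continuous functions $f$ on $G$: for every $\varepsilon>0$ there is a neighborhood $U$ of $e$ such that $gh^{-1}\in U$ implies $|f(g)-f(h)|<\varepsilon$. For $f\in\mathbb{R}^{G}$ and $g\in G$, $(f\cdot g)(h):=f(gh)$, and $f\cdot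 G=\{f\cdot g:g\in G\}$. A function $f\in\mathrm{RUC}_{b}(G)$ is right Asplund (resp. right tame) if $f\cdot G$ is an Asplund (resp. tame) subset of $\mathrm{RUC}_{b}(G)$. (It holds that $f_{x,\phi}\in\mathrm{RUC}_{b}(G)$.) For $a,b\in\mathcal{A}$, $\varphi\in\mathcal{A}^{*}$: $\langle a\circledast\varphi,b\rangle:=\langle\varphi,ba\rangle$. A functional $\varphi\in\mathcal{A}^{*}$ is left Asplund (resp. left tame) if $B_{\mathcal{A}}\circledast\varphi=\{a\circledast\varphi:a\in B_{\mathcal{A}}\}$ is an Asplund (resp. tame) subset of $\mathcal{A}^{*}$. A bounded subset $C$ of a Banach space $W$ is Asplund if it is a fragmented family of functions on $(B_{W^{*}},w^{*})$: for every nonempty $A\subseteq B_{W^{*}}$ and $\varepsilon>0$ there is a weak-star open $O$ with $O\cap A\ne\emptyset$ and $\mathrm{diam}\,\{\langle\psi,c\rangle:\psi\in O\cap A\}<\varepsilon$ for all $c\in C$. It is tame if it contains no $\ell^{1}$-sequence (equivalently, every sequence in $C$ has a weak-Cauchy subsequence). *)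

theory Defs
  imports "HOL-Analysis.Analysis" "HOL-Library.Function_Algebras"
begin

instantiation "fun" :: (type, real_vector) real_vector
begin

definition scaleR_fun :: "real \<Rightarrow> ('a \<Rightarrow> 'b) \<Rightarrow> 'a \<Rightarrow> 'b"
  where "scaleR_fun c f = (\<lambda>x. c *\<^sub>R f x)"

instance
  by standard (simp_all add: scaleR_fun_def fun_eq_iff scaleR_add_right scaleR_add_left)

end

(* The Banach spaces involved (a closed subalgebra of L(V), its dual, the bidual, RUC_b(G)) depend on
   the data, so a Banach space is given by a linear subspace W of an ambient real vector space
   together with a norm N, of which only the values on W matter. *)

(* A functional on W is represented by its extension by zero outside W, so that equality of
   functionals is equality of functions and W* is again a linear subspace of a function space. *)
definition dual_space :: "'w::real_vector set \<Rightarrow> ('w \<Rightarrow> real) \<Rightarrow> ('w \<Rightarrow> real) set" where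
  "dual_space W N = {\<psi>.
     (\<forall>x\<in>W. \<forall>y\<in>W. \<psi> (x + y) = \<psi> x + \<psi> y) \<and>
     (\<forall>c. \<forall>x\<in>W. \<psi> (c *\<^sub>R x) = c * \<psi> x) \<and>
     (\<exists>K. \<forall>x\<in>W. \<bar>\<psi> x\<bar> \<le> K * N x) \<and>
     (\<forall>x. x \<notin> W \<longrightarrow> \<psi> x = 0)}"

definition dual_norm :: "'w::real_vector set \<Rightarrow> ('w \<Rightarrow> real) \<Rightarrow> ('w \<Rightarrow> real) \<Rightarrow> real" where
  "dual_norm W N \<psi> = (SUP x\<in>{x \<in> W. N x \<le> 1}. \<bar>\<psi> x\<bar>)"

definition dual_ball :: "'w::real_vector set \<Rightarrow> ('w \<Rightarrow> real) \<Rightarrow> ('w \<Rightarrow> real) set" where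
  "dual_ball W N = {\<psi> \<in> dual_space W N. dual_norm W N \<psi> \<le> 1}"

definition weak_star :: "'w::real_vector set \<Rightarrow> ('w \<Rightarrow> real) \<Rightarrow> ('w \<Rightarrow> real) topology" where
  "weak_star W N = topology_generated_by
     {{\<psi> \<in> dual_space W N. \<psi> x \<in> U} | x U. x \<in> W \<and> open U}"

definition bounded_subset :: "'w::real_vector set \<Rightarrow> ('w \<Rightarrow> real) \<Rightarrow> 'w set \<Rightarrow> bool" where
  "bounded_subset W N C \<longleftrightarrow> C \<subseteq> W \<and> (\<exists>K. \<forall>c\<in>C. N c \<le> K)"

definition asplund_subset :: "'w::real_vector set \<Rightarrow> ('w \<Rightarrow> real) \<Rightarrow> 'w set \<Rightarrow> bool" where
  "asplund_subset W N C \<longleftrightarrow> bounded_subset W N C \<and>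
     (\<forall>A \<epsilon>. A \<subseteq> dual_ball W N \<and> A \<noteq> {} \<and> \<epsilon> > 0 \<longrightarrow>
       (\<exists>O'. openin (weak_star W N) O' \<and> O' \<inter> A \<noteq> {} \<and>
          (\<forall>c\<in>C. diameter ((\<lambda>\<psi>. \<psi> c) ` (O' \<inter> A)) < \<epsilon>)))"

(* equivalence to the standard basis of l^1; the upper estimate is boundedness of the sequence *)
definition l1_sequence :: "('w::real_vector \<Rightarrow> real) \<Rightarrow> (nat \<Rightarrow> 'w) \<Rightarrow> bool" where
  "l1_sequence N s \<longleftrightarrow> (\<exists>K. \<forall>n. N (s n) \<le> K) \<and>
     (\<exists>\<delta>>0. \<forall>n c. \<delta> * (\<Sum>i<n. \<bar>c i\<bar>) \<le> N (\<Sum>i<n. c i *\<^sub>R s i))"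

definition tame_subset :: "'w::real_vector set \<Rightarrow> ('w \<Rightarrow> real) \<Rightarrow> 'w set \<Rightarrow> bool" where
  "tame_subset W N C \<longleftrightarrow> bounded_subset W N C \<and>
     \<not> (\<exists>s. range s \<subseteq> C \<and> l1_sequence N s)"

(* The group is written additively, as in class topological_group_add, which does not assume
   commutativity: g h, h^{-1}, e become g + h, - h, 0. *)

definition Iso :: "('v::real_normed_vector \<Rightarrow>\<^sub>L 'v) set" where
  "Iso = {T. surj (blinfun_apply T) \<and> (\<forall>x. norm (blinfun_apply T x) = norm x)}"

definition strongly_continuous_rep ::
    "('g::topological_group_add \<Rightarrow> ('v::real_normed_vector \<Rightarrow>\<^sub>L 'v)) \<Rightarrow> bool" where
  "strongly_continuous_rep \<alpha> \<longleftrightarrow>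
     range \<alpha> \<subseteq> Iso \<and>
     (\<forall>g h. \<alpha> (g + h) = \<alpha> h o\<^sub>L \<alpha> g) \<and>
     (\<forall>x. continuous_on UNIV (\<lambda>g. blinfun_apply (\<alpha> g) x))"

definition rep_algebra :: "('g \<Rightarrow> ('v::real_normed_vector \<Rightarrow>\<^sub>L 'v)) \<Rightarrow> ('v \<Rightarrow>\<^sub>L 'v) set" where
  "rep_algebra \<alpha> = closure (span (range \<alpha>))"

definition matrix_functional ::
    "('v \<Rightarrow>\<^sub>L 'v) set \<Rightarrow> 'v::real_normed_vector \<Rightarrow> ('v \<Rightarrow>\<^sub>L real) \<Rightarrow> ('v \<Rightarrow>\<^sub>L 'v) \<Rightarrow> real" where
  "matrix_functional A x \<phi> = (\<lambda>b. if b \<in> A then blinfun_apply \<phi> (blinfun_apply b x) else 0)"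

definition matrix_coefficient ::
    "('g \<Rightarrow> ('v \<Rightarrow>\<^sub>L 'v)) \<Rightarrow> 'v::real_normed_vector \<Rightarrow> ('v \<Rightarrow>\<^sub>L real) \<Rightarrow> 'g \<Rightarrow> real" where
  "matrix_coefficient \<alpha> x \<phi> = (\<lambda>g. matrix_functional (rep_algebra \<alpha>) x \<phi> (\<alpha> g))"

definition functional_act ::
    "('v::real_normed_vector \<Rightarrow>\<^sub>L 'v) set \<Rightarrow> ('v \<Rightarrow>\<^sub>L 'v) \<Rightarrow> (('v \<Rightarrow>\<^sub>L 'v) \<Rightarrow> real) \<Rightarrow> ('v \<Rightarrow>\<^sub>L 'v) \<Rightarrow> real" where
  "functional_act A a \<phi> = (\<lambda>b. if b \<in> A then \<phi> (b o\<^sub>L a) else 0)"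

definition ball_orbit ::
    "('v::real_normed_vector \<Rightarrow>\<^sub>L 'v) set \<Rightarrow> (('v \<Rightarrow>\<^sub>L 'v) \<Rightarrow> real) \<Rightarrow> (('v \<Rightarrow>\<^sub>L 'v) \<Rightarrow> real) set" where
  "ball_orbit A \<phi> = {functional_act A a \<phi> | a. a \<in> A \<and> norm a \<le> 1}"

definition left_asplund ::
    "('v::real_normed_vector \<Rightarrow>\<^sub>L 'v) set \<Rightarrow> (('v \<Rightarrow>\<^sub>L 'v) \<Rightarrow> real) \<Rightarrow> bool" where
  "left_asplund A \<phi> \<longleftrightarrow> \<phi> \<in> dual_space A norm \<and>
     asplund_subset (dual_space A norm) (dual_norm A norm) (ball_orbit A \<phi>)"

definition left_tame ::
    "('v::real_normed_vector \<Rightarrow>\<^sub>L 'v) set \<Rightarrow> (('v \<Rightarrow>\<^sub>L 'v) \<Rightarrow> real) \<Rightarrow> bool" where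
  "left_tame A \<phi> \<longleftrightarrow> \<phi> \<in> dual_space A norm \<and>
     tame_subset (dual_space A norm) (dual_norm A norm) (ball_orbit A \<phi>)"

definition RUCb :: "('g::topological_group_add \<Rightarrow> real) set" where
  "RUCb = {f. bounded (range f) \<and>
     (\<forall>\<epsilon>>0. \<exists>U. open U \<and> 0 \<in> U \<and> (\<forall>g h. g - h \<in> U \<longrightarrow> \<bar>f g - f h\<bar> < \<epsilon>))}"

definition sup_norm :: "('g \<Rightarrow> real) \<Rightarrow> real" where
  "sup_norm f = (SUP g. \<bar>f g\<bar>)"

definition translate :: "('g::group_add \<Rightarrow> real) \<Rightarrow> 'g \<Rightarrow> 'g \<Rightarrow> real" where
  "translate f g = (\<lambda>h. f (g + h))"

definition right_asplund :: "('g::topological_group_add \<Rightarrow> real) \<Rightarrow> bool" where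
  "right_asplund f \<longleftrightarrow> f \<in> RUCb \<and> asplund_subset RUCb sup_norm (range (translate f))"

definition right_tame :: "('g::topological_group_add \<Rightarrow> real) \<Rightarrow> bool" where
  "right_tame f \<longleftrightarrow> f \<in> RUCb \<and> tame_subset RUCb sup_norm (range (translate f))"

end

(* Sending a functional y on the algebra to the function g |-> y (\<alpha> g) is a linear contraction T that
   maps the functional \<alpha> g acting on the matrix functional to the translate of the matrix coefficient
   by g. A contraction cannot create l^1-sequences, so tameness passes to the image. For Asplund sets,
   every element of the dual ball of RUCb pulls back along T and extends by Hahn--Banach to an
   element of the dual ball of the dual of the algebra; fragmentability then descends through this
   correspondence by taking, in the weak-star compact upper ball, a minimal compact set of lifts.

   The function y \<circ> \<alpha> need not be continuous on the group (\<alpha> is only strongly continuous), so T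
   need not map into RUCb; hence the extension step. *)
theory Submission
  imports Defs
begin

section \<open>The Hahn--Banach theorem\<close>

definition sublinear :: "('w::real_vector \<Rightarrow> real) \<Rightarrow> bool" where
  "sublinear p \<longleftrightarrow> (\<forall>x y. p (x + y) \<le> p x + p y) \<and> (\<forall>c x. c \<ge> 0 \<longrightarrow> p (c *\<^sub>R x) = c * p x)"

lemma sublinear_add: "sublinear p \<Longrightarrow> p (x + y) \<le> p x + p y"
  by (simp add: sublinear_def)

lemma sublinear_scaleR: "sublinear p \<Longrightarrow> c \<ge> 0 \<Longrightarrow> p (c *\<^sub>R x) = c * p x"
  by (simp add: sublinear_def)

lemma sublinear_0: "sublinear p \<Longrightarrow> p 0 = 0"
  using sublinear_scaleR[of p 0 0] by simp

lemma sublinear_uminus_ge: "sublinear p \<Longrightarrow> - p (- x) \<le> p x"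
  using sublinear_add[of p x "- x"] sublinear_0[of p] by simp

(* It suffices to check homogeneity as an inequality for positive scalars, since the scalar
   1/c gives the reverse inequality. *)
lemma sublinearI:
  assumes "\<And>x y. p (x + y) \<le> p x + p y" "p 0 = 0"
    and "\<And>c x. c > 0 \<Longrightarrow> p (c *\<^sub>R x) \<le> c * p x"
  shows "sublinear p"
proof -
  have "p (c *\<^sub>R x) = c * p x" if "c \<ge> 0" for c x
  proof (cases "c = 0")
    case False
    then have c: "c > 0" using that by simp
    have "p x \<le> (1 / c) * p (c *\<^sub>R x)"
      using assms(3)[of "1 / c" "c *\<^sub>R x"] c by simp
    then show ?thesis
      using assms(3)[OF c, of x] c by (simp add: field_simps)
  qed (simp add: assms(2))
  then show ?thesis by (simp add: sublinear_def assms(1))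
qed

text \<open>Chain step for Zorn's lemma. The infimum is finite since
  \<open>- p (- x) \<le> - q (- x) \<le> q x\<close> for every member \<open>q\<close>.
  Subadditivity uses comparability: the smaller of two members bounds both summands at once.\<close>

lemma INF_chain_sublinear:
  assumes C: "C \<noteq> {}" "\<And>q. q \<in> C \<Longrightarrow> sublinear q \<and> q \<le> p"
    and chain: "\<And>q r. q \<in> C \<Longrightarrow> r \<in> C \<Longrightarrow> q \<le> r \<or> r \<le> q"
  defines "u \<equiv> \<lambda>x. INF q\<in>C. q x"
  shows "sublinear u" "q \<in> C \<Longrightarrow> u \<le> q"
proof -
  have bdd: "bdd_below ((\<lambda>q. q x) ` C)" for x
  proof (rule bdd_belowI2)
    fix q assume "q \<in> C"
    then show "- p (- x) \<le> q x"
      using C(2)[of q] sublinear_uminus_ge[of q x] by (auto simp: le_fun_def intro: order_trans[of _ "- q (- x)"])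
  qed
  have low: "u x \<le> q x" if "q \<in> C" for q x
    unfolding u_def using bdd that by (rule cINF_lower)
  show "q \<in> C \<Longrightarrow> u \<le> q" using low by (simp add: le_fun_def)
  show "sublinear u"
  proof (rule sublinearI)
    fix x y
    have *: "u (x + y) \<le> q x + r y" if "q \<in> C" "r \<in> C" for q r
    proof -
      have "\<exists>s\<in>C. s \<le> q \<and> s \<le> r" using chain[of q r] that by blast
      then obtain s where s: "s \<in> C" "s \<le> q" "s \<le> r" by blast
      have "u (x + y) \<le> s (x + y)" using low s by blast
      also have "\<dots> \<le> s x + s y" using C(2) s sublinear_add by blast
      finally show ?thesis using s(2,3) by (smt (verit) le_funD)
    qed
    \<comment> \<open>The two infima are taken one after the other: over the second functional with
      \<open>q\<close> fixed, then over \<open>q\<close>.\<close>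
    have "u (x + y) - q x \<le> u y" if "q \<in> C" for q
      unfolding u_def using *[OF that] C(1) by (intro cINF_greatest) (auto simp: u_def algebra_simps)
    then have "u (x + y) - u y \<le> u x"
      using C(1) by (subst (3) u_def, intro cINF_greatest) (auto simp: algebra_simps)
    then show "u (x + y) \<le> u x + u y" by simp
  next
    have "(\<lambda>q. q 0) ` C = {0}" using C sublinear_0 by force
    then show "u 0 = 0" by (simp add: u_def)
  next
    fix c :: real and x assume c: "c > 0"
    have "u (c *\<^sub>R x) / c \<le> q x" if "q \<in> C" for q
      using low[OF that, of "c *\<^sub>R x"] sublinear_scaleR[of q c x] C(2)[OF that] c by (simp add: field_simps)
    then have "u (c *\<^sub>R x) / c \<le> u x"
      using C(1) by (subst (2) u_def, intro cINF_greatest) auto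
    then show "u (c *\<^sub>R x) \<le> c * u x" using c by (simp add: field_simps)
  qed
qed

text \<open>Zorn's lemma for the reversed pointwise order: \<open>p\<close> itself bounds the empty
  chain, the pointwise infimum bounds every other chain.\<close>

lemma ex_minimal_sublinear:
  assumes "sublinear p"
  obtains m where "sublinear m" "m \<le> p" "\<And>q. sublinear q \<Longrightarrow> q \<le> m \<Longrightarrow> q = m"
proof -
  define S where "S = {q. sublinear q \<and> q \<le> p}"
  have "\<exists>m\<in>S. \<forall>a\<in>S. a \<le> m \<longrightarrow> a = m"
  proof (rule predicate_Zorn[where P = "\<lambda>a b. b \<le> a"])
    show "partial_order_on S (relation_of (\<lambda>a b. b \<le> a) S)"
      by (rule partial_order_on_relation_ofI) auto
    fix C assume "C \<in> Chains (relation_of (\<lambda>a b. b \<le> a) S)"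
    then have C: "\<And>q. q \<in> C \<Longrightarrow> sublinear q \<and> q \<le> p"
      and chain: "\<And>q r. q \<in> C \<Longrightarrow> r \<in> C \<Longrightarrow> q \<le> r \<or> r \<le> q"
      unfolding Chains_def relation_of_def S_def by blast+
    show "\<exists>u\<in>S. \<forall>a\<in>C. u \<le> a"
    proof (cases "C = {}")
      case True
      then show ?thesis using assms by (auto simp: S_def)
    next
      case False
      note u = INF_chain_sublinear[OF False C chain]
      obtain q where "q \<in> C" using False by blast
      then have "(\<lambda>x. INF q\<in>C. q x) \<le> p" using u(2) C order_trans by blast
      then show ?thesis using u by (auto simp: S_def intro!: bexI[of _ "\<lambda>x. INF q\<in>C. q x"])
    qed
  qed
  then obtain m where "m \<in> S" "\<And>q. q \<in> S \<Longrightarrow> q \<le> m \<Longrightarrow> q = m" by blast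
  then show ?thesis using that[of m] by (auto simp: S_def dest: order_trans)
qed

(* For a minimal m, comparison with the sublinear functional x |-> inf_t m (x + t a) - t m a
   gives m x + m a \<le> m (x + a). *)
lemma minimal_sublinear_linear:
  assumes m: "sublinear m" and min: "\<And>q. sublinear q \<Longrightarrow> q \<le> m \<Longrightarrow> q = m"
  shows "linear m"
proof -
  have super: "m x + m a \<le> m (x + a)" for x a
  proof -
    define q where "q = (\<lambda>x. INF t\<in>{0..}. m (x + t *\<^sub>R a) - t * m a)"
    \<comment> \<open>The infimum is finite because \<open>t * m a = m (t *\<^sub>R a) \<le> m (x +
      t *\<^sub>R a) + m (- x)\<close>.\<close>
    have bdd: "bdd_below ((\<lambda>t. m (x + t *\<^sub>R a) - t * m a) ` {0..})" for x
    proof (rule bdd_belowI2)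
      fix t :: real assume "t \<in> {0..}"
      then show "- m (- x) \<le> m (x + t *\<^sub>R a) - t * m a"
        using sublinear_add[OF m, of "x + t *\<^sub>R a" "- x"] sublinear_scaleR[OF m, of t a] by simp
    qed
    have low: "q x \<le> m (x + t *\<^sub>R a) - t * m a" if "t \<ge> 0" for t x
      unfolding q_def using bdd by (rule cINF_lower) (use that in simp)
    have great: "z \<le> q x" if "\<And>t. t \<ge> 0 \<Longrightarrow> z \<le> m (x + t *\<^sub>R a) - t * m a" for z x
      unfolding q_def using that by (intro cINF_greatest) auto
    have qm: "q \<le> m" using low[of 0] by (simp add: le_fun_def)
    have "sublinear q"
    proof (rule sublinearI)
      fix x y
      \<comment> \<open>Parameters \<open>s\<close> for \<open>x\<close> and \<open>t\<close> for
        \<open>y\<close> combine to the parameter \<open>s + t\<close> for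
        \<open>x + y\<close>.\<close>
      have *: "q (x + y) \<le> (m (x + s *\<^sub>R a) - s * m a) + (m (y + t *\<^sub>R a) - t * m a)"
        if "s \<ge> 0" "t \<ge> 0" for s t
        using low[of "s + t" "x + y"] that sublinear_add[OF m, of "x + s *\<^sub>R a" "y + t *\<^sub>R a"]
        by (simp add: algebra_simps)
      have "q (x + y) - (m (x + s *\<^sub>R a) - s * m a) \<le> q y" if "s \<ge> 0" for s
        using *[OF that] by (intro great) (simp add: algebra_simps)
      then have "q (x + y) - q y \<le> q x"
        by (intro great) (simp add: algebra_simps)
      then show "q (x + y) \<le> q x + q y" by simp
    next
      show "q 0 = 0"
        using great[of 0 0] low[of 0 0] sublinear_0[OF m] sublinear_scaleR[OF m] by (auto intro: antisym)
    next
      fix c :: real and x assume c: "c > 0"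
      have "q (c *\<^sub>R x) / c \<le> m (x + t *\<^sub>R a) - t * m a" if "t \<ge> 0" for t
        using low[of "c * t" "c *\<^sub>R x"] that c sublinear_scaleR[OF m, of c "x + t *\<^sub>R a"]
        by (simp add: field_simps scaleR_add_right)
      then have "q (c *\<^sub>R x) / c \<le> q x" by (rule great)
      then show "q (c *\<^sub>R x) \<le> c * q x" using c by (simp add: field_simps)
    qed
    then have "q = m" using min qm by blast
    \<comment> \<open>Once \<open>q = m\<close>, the parameter \<open>t = 1\<close> in the infimum
      is the desired inequality.\<close>
    then show ?thesis using low[of 1 x] by simp
  qed
  have add: "m (x + y) = m x + m y" for x y
    using super[of x y] sublinear_add[OF m, of x y] by simp
  have neg: "m (- x) = - m x" for x
    using add[of x "- x"] sublinear_0[OF m] by simp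
  have "m (c *\<^sub>R x) = c * m x" for c x
  proof (cases "c \<ge> 0")
    case False
    then show ?thesis using sublinear_scaleR[OF m, of "- c" x] neg[of "c *\<^sub>R x"] by simp
  qed (simp add: sublinear_scaleR[OF m])
  then show ?thesis using add by (intro linearI) auto
qed

text \<open>The functional \<open>q x = inf {p (x - y) + l y | y \<in> Y}\<close> encodes the
  extension problem: it is sublinear, lies below \<open>p\<close> (take \<open>y = 0\<close>) and
  below \<open>l\<close> on \<open>Y\<close> (take \<open>y = x\<close>). A minimal sublinear
  \<open>m\<close> below \<open>q\<close> is linear, and \<open>m \<le> l\<close> on
  \<open>Y\<close>, applied to \<open>y\<close> and \<open>- y\<close>, gives equality. Zorn's lemma
  thus acts on sublinear functionals instead of on partial extensions.\<close>

theorem hahn_banach: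
  assumes p: "sublinear p" and Y: "subspace Y"
    and add: "\<And>x y. x \<in> Y \<Longrightarrow> y \<in> Y \<Longrightarrow> l (x + y) = l x + l y"
    and scale: "\<And>c x. x \<in> Y \<Longrightarrow> l (c *\<^sub>R x) = c * l x"
    and le: "\<And>y. y \<in> Y \<Longrightarrow> l y \<le> p y"
  obtains m where "linear m" "\<And>x. m x \<le> p x" "\<And>y. y \<in> Y \<Longrightarrow> m y = l y"
proof -
  define q where "q = (\<lambda>x. INF y\<in>Y. p (x - y) + l y)"
  have l0: "l 0 = 0" using scale[of 0 0] subspace_0[OF Y] by simp
  have neg: "- y \<in> Y \<and> l (- y) = - l y" if "y \<in> Y" for y
    using scale[OF that, of "- 1"] subspace_neg[OF Y that] by simp
  \<comment> \<open>Lower bound: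
    \<open>- l y = l (- y) \<le> p (- y) \<le> p (x - y) + p (- x)\<close>.\<close>
  have bdd: "bdd_below ((\<lambda>y. p (x - y) + l y) ` Y)" for x
  proof (rule bdd_belowI2)
    fix y assume "y \<in> Y"
    then have "- l y \<le> p (- y)" using neg le by fastforce
    then show "- p (- x) \<le> p (x - y) + l y"
      using sublinear_add[OF p, of "x - y" "- x"] by simp
  qed
  have low: "q x \<le> p (x - y) + l y" if "y \<in> Y" for x y
    unfolding q_def using bdd that by (rule cINF_lower)
  have great: "z \<le> q x" if "\<And>y. y \<in> Y \<Longrightarrow> z \<le> p (x - y) + l y" for z x
    unfolding q_def using that subspace_0[OF Y] by (intro cINF_greatest) auto
  have "sublinear q"
  proof (rule sublinearI)
    fix x y
    have *: "q (x + y) \<le> (p (x - s) + l s) + (p (y - t) + l t)" if "s \<in> Y" "t \<in> Y" for s t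
      using low[OF subspace_add[OF Y that], of "x + y"] add[OF that]
        sublinear_add[OF p, of "x - s" "y - t"] by (simp add: algebra_simps)
    have "q (x + y) - (p (x - s) + l s) \<le> q y" if "s \<in> Y" for s
      using *[OF that] by (intro great) (simp add: algebra_simps)
    then have "q (x + y) - q y \<le> q x"
      by (intro great) (simp add: algebra_simps)
    then show "q (x + y) \<le> q x + q y" by simp
  next
    have "0 \<le> p (0 - y) + l y" if "y \<in> Y" for y
      using neg[OF that] le[of "- y"] by simp
    then show "q 0 = 0"
      using low[OF subspace_0[OF Y], of 0] sublinear_0[OF p] l0 great[of 0 0] by simp
  next
    fix c :: real and x assume c: "c > 0"
    have "q (c *\<^sub>R x) / c \<le> p (x - y) + l y" if "y \<in> Y" for y
      using low[OF subspace_scale[OF Y that], of "c *\<^sub>R x" c] scale[OF that, of c] c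
        sublinear_scaleR[OF p, of c "x - y"]
      by (simp add: field_simps scaleR_diff_right)
    then have "q (c *\<^sub>R x) / c \<le> q x" by (rule great)
    then show "q (c *\<^sub>R x) \<le> c * q x" using c by (simp add: field_simps)
  qed
  then obtain m where m: "sublinear m" "m \<le> q" "\<And>r. sublinear r \<Longrightarrow> r \<le> m \<Longrightarrow> r = m"
    using ex_minimal_sublinear by blast
  have lin: "linear m" using minimal_sublinear_linear m(1,3) by blast
  have qp: "q x \<le> p x" for x using low[OF subspace_0[OF Y], of x] l0 by simp
  have mle: "m y \<le> l y" if "y \<in> Y" for y
    using low[OF that, of y] m(2) sublinear_0[OF p] by (auto simp: le_fun_def intro: order_trans)
  have "m y = l y" if "y \<in> Y" for y
    using mle[OF that] mle[of "- y"] neg[OF that] linear_neg[OF lin, of y] by simp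
  then show ?thesis
    using that lin m(2) qp by (meson le_funD order_trans)
qed

section \<open>Seminormed subspaces and the weak-star compactness of the dual ball\<close>

text \<open>The common interface of the algebra, its dual and \<open>RUCb\<close>, so that dual
  balls of all three are treated by the same lemmas. As in the definitions of the dual, only the
  values of \<open>N\<close> on \<open>W\<close> count.\<close>

definition seminorm_on :: "'w::real_vector set \<Rightarrow> ('w \<Rightarrow> real) \<Rightarrow> bool" where
  "seminorm_on W N \<longleftrightarrow> subspace W \<and> (\<forall>x\<in>W. \<forall>y\<in>W. N (x + y) \<le> N x + N y) \<and>
     (\<forall>c. \<forall>x\<in>W. N (c *\<^sub>R x) = \<bar>c\<bar> * N x)"

lemma seminorm_on_subspace: "seminorm_on W N \<Longrightarrow> subspace W"
  by (simp add: seminorm_on_def)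

lemma seminorm_on_scaleR: "seminorm_on W N \<Longrightarrow> x \<in> W \<Longrightarrow> N (c *\<^sub>R x) = \<bar>c\<bar> * N x"
  by (simp add: seminorm_on_def)

lemma seminorm_on_0: "seminorm_on W N \<Longrightarrow> N 0 = 0"
  using seminorm_on_scaleR[of W N 0 0] by (simp add: seminorm_on_def subspace_0)

lemma seminorm_on_nonneg: "seminorm_on W N \<Longrightarrow> x \<in> W \<Longrightarrow> 0 \<le> N x"
proof -
  assume N: "seminorm_on W N" and x: "x \<in> W"
  have "- x \<in> W" using N x by (simp add: seminorm_on_subspace subspace_neg)
  then have "N (x + - x) \<le> N x + N (- x)" using N x unfolding seminorm_on_def by blast
  then show "0 \<le> N x"
    using seminorm_on_0[OF N] seminorm_on_scaleR[OF N x, of "- 1"] by simp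
qed

text \<open>This legitimates the supremum in \<open>dual_norm\<close>, since a real
  \<open>SUP\<close> is informative only over a set that is bounded above.\<close>

lemma bdd_above_dual_norm:
  assumes N: "seminorm_on W N" and \<psi>: "\<psi> \<in> dual_space W N"
  shows "bdd_above ((\<lambda>x. \<bar>\<psi> x\<bar>) ` {x \<in> W. N x \<le> 1})"
proof -
  obtain K where K: "\<And>x. x \<in> W \<Longrightarrow> \<bar>\<psi> x\<bar> \<le> K * N x"
    using \<psi> unfolding dual_space_def by blast
  show ?thesis
  proof (rule bdd_aboveI2)
    fix x assume x: "x \<in> {x \<in> W. N x \<le> 1}"
    \<comment> \<open>\<open>K\<close> comes without a sign, hence the passage to its absolute
      value.\<close>
    have "K * N x \<le> \<bar>K\<bar> * 1" using x seminorm_on_nonneg[OF N, of x] by (intro mult_mono) auto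
    then show "\<bar>\<psi> x\<bar> \<le> \<bar>K\<bar>" using K[of x] x by simp
  qed
qed

text \<open>Rescaling \<open>x\<close> to seminorm one reduces the bound to the supremum. If
  \<open>N x = 0\<close>, where rescaling is impossible, the bound by \<open>K * N x\<close> in
  \<open>dual_space\<close> already forces the value 0.\<close>

lemma abs_le_dual_norm:
  assumes N: "seminorm_on W N" and \<psi>: "\<psi> \<in> dual_space W N" and x: "x \<in> W"
  shows "\<bar>\<psi> x\<bar> \<le> dual_norm W N \<psi> * N x"
proof -
  obtain K where K: "\<And>x. x \<in> W \<Longrightarrow> \<bar>\<psi> x\<bar> \<le> K * N x"
    using \<psi> unfolding dual_space_def by blast
  consider "N x = 0" | "N x > 0" using seminorm_on_nonneg[OF N x] by linarith
  then show ?thesis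
  proof cases
    case 1
    then show ?thesis using K[OF x] by simp
  next
    case 2
    let ?y = "(1 / N x) *\<^sub>R x"
    have y: "?y \<in> {x \<in> W. N x \<le> 1}"
      using 2 x seminorm_on_scaleR[OF N x, of "1 / N x"] subspace_scale[OF seminorm_on_subspace[OF N] x, of "1 / N x"]
      by simp
    have "\<bar>\<psi> ?y\<bar> \<le> dual_norm W N \<psi>"
      unfolding dual_norm_def using bdd_above_dual_norm[OF N \<psi>] y by (rule cSUP_upper2) simp
    moreover have "\<psi> ?y = (1 / N x) * \<psi> x"
      using \<psi> x by (simp add: dual_space_def)
    ultimately show ?thesis using 2 by (simp add: abs_mult field_simps)
  qed
qed

lemma dual_norm_le:
  assumes N: "seminorm_on W N" and K: "K \<ge> 0" and le: "\<And>x. x \<in> W \<Longrightarrow> \<bar>\<psi> x\<bar> \<le> K * N x"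
  shows "dual_norm W N \<psi> \<le> K"
  unfolding dual_norm_def
proof (rule cSUP_least)
  show "{x \<in> W. N x \<le> 1} \<noteq> {}"
    using subspace_0[OF seminorm_on_subspace[OF N]] seminorm_on_0[OF N] by force
  fix x assume x: "x \<in> {x \<in> W. N x \<le> 1}"
  then have "K * N x \<le> K" using K by (simp add: mult_left_le)
  then show "\<bar>\<psi> x\<bar> \<le> K" using le[of x] x by simp
qed

lemma dual_norm_nonneg:
  assumes N: "seminorm_on W N" and \<psi>: "\<psi> \<in> dual_space W N"
  shows "0 \<le> dual_norm W N \<psi>"
proof -
  have 0: "0 \<in> {x \<in> W. N x \<le> 1}"
    using subspace_0[OF seminorm_on_subspace[OF N]] seminorm_on_0[OF N] by simp
  show ?thesis
    unfolding dual_norm_def using bdd_above_dual_norm[OF N \<psi>] 0 by (rule cSUP_upper2) simp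
qed

text \<open>Pointwise conditions replace the supremum and the existential bound. In this form the
  ball is visibly cut out of a product of intervals by linear equations.\<close>

lemma mem_dual_ball_iff:
  assumes N: "seminorm_on W N"
  shows "\<psi> \<in> dual_ball W N \<longleftrightarrow>
     (\<forall>x\<in>W. \<forall>y\<in>W. \<psi> (x + y) = \<psi> x + \<psi> y) \<and> (\<forall>c. \<forall>x\<in>W. \<psi> (c *\<^sub>R x) = c * \<psi> x) \<and>
     (\<forall>x\<in>W. \<bar>\<psi> x\<bar> \<le> N x) \<and> (\<forall>x. x \<notin> W \<longrightarrow> \<psi> x = 0)" (is "_ \<longleftrightarrow> ?R")
proof
  assume "\<psi> \<in> dual_ball W N"
  then have \<psi>: "\<psi> \<in> dual_space W N" and le: "dual_norm W N \<psi> \<le> 1" by (auto simp: dual_ball_def)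
  have "\<bar>\<psi> x\<bar> \<le> N x" if "x \<in> W" for x
    using abs_le_dual_norm[OF N \<psi> that] mult_right_mono[OF le seminorm_on_nonneg[OF N that]] by simp
  then show ?R using \<psi> by (auto simp: dual_space_def)
next
  assume R: ?R
  then have "\<forall>x\<in>W. \<bar>\<psi> x\<bar> \<le> 1 * N x" by simp
  then have "\<psi> \<in> dual_space W N" using R unfolding dual_space_def by blast
  then show "\<psi> \<in> dual_ball W N"
    using dual_norm_le[OF N, of 1 \<psi>] R by (simp add: dual_ball_def)
qed

text \<open>This allows the dual to be iterated: Asplund subsets of the dual of the algebra are
  tested on the ball of its bidual.\<close>

lemma seminorm_on_dual:
  assumes N: "seminorm_on W N"
  shows "seminorm_on (dual_space W N) (dual_norm W N)"
proof -
  have add: "\<psi> + \<theta> \<in> dual_space W N \<and> dual_norm W N (\<psi> + \<theta>) \<le> dual_norm W N \<psi> + dual_norm W N \<theta>"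
    if \<psi>: "\<psi> \<in> dual_space W N" and \<theta>: "\<theta> \<in> dual_space W N" for \<psi> \<theta>
  proof
    have le: "\<bar>(\<psi> + \<theta>) x\<bar> \<le> (dual_norm W N \<psi> + dual_norm W N \<theta>) * N x" if "x \<in> W" for x
      using abs_le_dual_norm[OF N \<psi> that] abs_le_dual_norm[OF N \<theta> that] by (simp add: algebra_simps)
    then have "\<exists>K. \<forall>x\<in>W. \<bar>(\<psi> + \<theta>) x\<bar> \<le> K * N x" by blast
    then show "\<psi> + \<theta> \<in> dual_space W N"
      using \<psi> \<theta> by (simp add: dual_space_def distrib_left)
    show "dual_norm W N (\<psi> + \<theta>) \<le> dual_norm W N \<psi> + dual_norm W N \<theta>"
      using le dual_norm_nonneg[OF N] \<psi> \<theta> by (intro dual_norm_le[OF N]) auto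
  qed
  have scale: "c *\<^sub>R \<psi> \<in> dual_space W N \<and> dual_norm W N (c *\<^sub>R \<psi>) \<le> \<bar>c\<bar> * dual_norm W N \<psi>"
    if \<psi>: "\<psi> \<in> dual_space W N" for c \<psi>
  proof
    have le: "\<bar>(c *\<^sub>R \<psi>) x\<bar> \<le> (\<bar>c\<bar> * dual_norm W N \<psi>) * N x" if "x \<in> W" for x
      using mult_left_mono[OF abs_le_dual_norm[OF N \<psi> that], of "\<bar>c\<bar>"]
      by (simp add: scaleR_fun_def abs_mult mult.assoc)
    then have "\<exists>K. \<forall>x\<in>W. \<bar>(c *\<^sub>R \<psi>) x\<bar> \<le> K * N x" by blast
    then show "c *\<^sub>R \<psi> \<in> dual_space W N"
      using \<psi> by (simp add: dual_space_def scaleR_fun_def algebra_simps)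
    show "dual_norm W N (c *\<^sub>R \<psi>) \<le> \<bar>c\<bar> * dual_norm W N \<psi>"
      using le dual_norm_nonneg[OF N \<psi>] by (intro dual_norm_le[OF N]) auto
  qed
  have scale_eq: "dual_norm W N (c *\<^sub>R \<psi>) = \<bar>c\<bar> * dual_norm W N \<psi>"
    if \<psi>: "\<psi> \<in> dual_space W N" for c \<psi>
  proof (cases "c = 0")
    case True
    then show ?thesis
      using scale[OF \<psi>, of 0] dual_norm_nonneg[OF N, of "0 *\<^sub>R \<psi>"] by simp
  next
    case False
    \<comment> \<open>Undoing the scaling by \<open>c\<close> with \<open>1 / c\<close> turns the
      inequality \<open>scale\<close> into an equality.\<close>
    have "dual_norm W N ((1 / c) *\<^sub>R (c *\<^sub>R \<psi>)) \<le> \<bar>1 / c\<bar> * dual_norm W N (c *\<^sub>R \<psi>)"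
      using scale[OF \<psi>, of c] scale by blast
    then have "\<bar>c\<bar> * dual_norm W N \<psi> \<le> dual_norm W N (c *\<^sub>R \<psi>)"
      using False by (simp add: field_simps)
    then show ?thesis using scale[OF \<psi>, of c] by simp
  qed
  have "0 \<in> dual_space W N"
    by (auto simp: dual_space_def intro!: exI[of _ 0])
  then have "subspace (dual_space W N)"
    using add scale by (simp add: subspace_def)
  then show ?thesis
    using add scale_eq by (simp add: seminorm_on_def)
qed

text \<open>A product of metric spaces is Hausdorff. It is applied below to the compact set of
  restrictions of functionals to \<open>C\<close>.\<close>

lemma compact_imp_closed_fun:
  fixes K :: "('a \<Rightarrow> 'b::metric_space) set"
  assumes "compact K"
  shows "closed K"
proof -
  have "Hausdorff_space (euclidean :: ('a \<Rightarrow> 'b) topology)"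
    unfolding euclidean_product_topology[symmetric] Hausdorff_space_product_topology by simp
  then show ?thesis
    using assms compactin_imp_closedin by fastforce
qed

text \<open>The Banach-Alaoglu theorem in the topology of pointwise convergence: by Tychonoff a
  product of compact intervals is compact, and the linearity conditions on \<open>W\<close> are
  closed.\<close>

lemma compact_dual_ball:
  assumes N: "seminorm_on W N"
  shows "compact (dual_ball W N)"
proof -
  \<comment> \<open>Outside \<open>W\<close> the interval shrinks to 0, which encodes the extension
    of functionals by zero.\<close>
  let ?b = "\<lambda>x. if x \<in> W then N x else 0"
  have "compactin (product_topology (\<lambda>_. euclidean) UNIV) (\<Pi>\<^sub>E x\<in>UNIV. {- ?b x..?b x})"
    by (subst compactin_PiE) auto
  then have cpt: "compact (\<Pi>\<^sub>E x\<in>UNIV. {- ?b x..?b x})"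
    by (simp add: euclidean_product_topology)
  have cl: "closed {\<psi> :: 'a \<Rightarrow> real. (\<forall>x\<in>W. \<forall>y\<in>W. \<psi> (x + y) = \<psi> x + \<psi> y) \<and> (\<forall>c. \<forall>x\<in>W. \<psi> (c *\<^sub>R x) = c * \<psi> x)}"
    unfolding Ball_def
    by (intro closed_Collect_conj closed_Collect_all closed_Collect_imp closed_Collect_eq open_Collect_const
        continuous_intros continuous_on_product_coordinates)
  have "dual_ball W N = (\<Pi>\<^sub>E x\<in>UNIV. {- ?b x..?b x}) \<inter>
      {\<psi>. (\<forall>x\<in>W. \<forall>y\<in>W. \<psi> (x + y) = \<psi> x + \<psi> y) \<and> (\<forall>c. \<forall>x\<in>W. \<psi> (c *\<^sub>R x) = c * \<psi> x)}"
    by (auto simp: set_eq_iff mem_dual_ball_iff[OF N] PiE_iff abs_le_iff minus_le_iff split: if_splits) (meson antisym)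
  then show ?thesis using cpt cl by (simp add: compact_Int_closed)
qed

text \<open>The inclusion of the dual into the function space carries the product topology to one at
  least as fine as the weak-star topology: each generating weak-star open set is the trace of a
  preimage under a coordinate evaluation. This makes product compactness available for weak-star
  open sets.\<close>

lemma openin_weak_star_restrict:
  assumes "openin (weak_star W N) O'"
  obtains G where "open G" "dual_space W N \<inter> O' = dual_space W N \<inter> G"
proof (cases "W = {}")
  \<comment> \<open>For empty \<open>W\<close> there are no generating sets, so the generated
    topology lives on the empty set and does not cover \<open>dual_space W N\<close>.\<close>
  case True
  then have "topspace (weak_star W N) = {}"
    by (auto simp: weak_star_def topology_generated_by_topspace)
  then have "O' = {}" using openin_subset[OF assms] by simp
  then show ?thesis using that[of "{}"] by simp
next
  case False
  have "continuous_map (top_of_set (dual_space W N)) (weak_star W N) id"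
    unfolding weak_star_def
  proof (rule continuous_on_generated_topo)
    fix U assume "U \<in> {{\<psi> \<in> dual_space W N. \<psi> x \<in> U} | x U. x \<in> W \<and> open U}"
    then obtain x V where U: "U = {\<psi> \<in> dual_space W N. \<psi> x \<in> V}" "open V" by blast
    have "open ((\<lambda>\<psi>. \<psi> x) -` V)" using U(2) by (intro open_vimage) auto
    moreover have "id -` U \<inter> topspace (top_of_set (dual_space W N)) = dual_space W N \<inter> (\<lambda>\<psi>. \<psi> x) -` V"
      using U by auto
    ultimately show "openin (top_of_set (dual_space W N)) (id -` U \<inter> topspace (top_of_set (dual_space W N)))"
      by (metis openin_open)
  next
    show "id ` topspace (top_of_set (dual_space W N)) \<subseteq> \<Union> {{\<psi> \<in> dual_space W N. \<psi> x \<in> U} | x U. x \<in> W \<and> open U}"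
      using False open_UNIV by auto
  qed
  then have "openin (top_of_set (dual_space W N)) {\<psi> \<in> dual_space W N. id \<psi> \<in> O'}"
    using openin_continuous_map_preimage[OF _ assms] by fastforce
  moreover have "{\<psi> \<in> dual_space W N. id \<psi> \<in> O'} = dual_space W N \<inter> O'" by auto
  ultimately show ?thesis using that by (metis openin_open)
qed

lemma topspace_weak_star: "W \<noteq> {} \<Longrightarrow> topspace (weak_star W N) = dual_space W N"
  using open_UNIV by (auto simp: weak_star_def)

lemma continuous_map_weak_star:
  assumes "x \<in> W"
  shows "continuous_map (weak_star W N) euclideanreal (\<lambda>\<psi>. \<psi> x)"
proof -
  have "openin (weak_star W N) {\<psi> \<in> topspace (weak_star W N). \<psi> x \<in> U}" if "open U" for U
  proof -
    have "openin (weak_star W N) {\<psi> \<in> dual_space W N. \<psi> x \<in> U}"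
      unfolding weak_star_def using that assms by (intro topology_generated_by_Basis) blast
    moreover have "W \<noteq> {}" using assms by blast
    ultimately show ?thesis by (simp add: topspace_weak_star)
  qed
  then show ?thesis by (simp add: continuous_map_def)
qed

section \<open>Linear contractions preserve Asplund and tame subsets\<close>

text \<open>The composite of \<psi> with \<open>T\<close> makes sense as a functional only on the
  subspace \<open>Y\<close> of those \<open>y\<close> in \<open>W\<close> with \<open>T y\<close> in
  \<open>W'\<close>. There it is dominated by \<open>N\<close>, because \<open>T\<close> is
  contractive, so Hahn-Banach extends it with the same bound.\<close>

lemma dual_ball_lift:
  assumes N: "seminorm_on W N" and N': "seminorm_on W' N'" and T: "linear T"
    and contr: "\<And>y. y \<in> W \<Longrightarrow> T y \<in> W' \<Longrightarrow> N' (T y) \<le> N y"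
    and \<psi>: "\<psi> \<in> dual_ball W' N'"
  shows "\<exists>\<Psi>\<in>dual_ball W N. \<forall>c\<in>W. T c \<in> W' \<longrightarrow> \<Psi> c = \<psi> (T c)"
proof -
  note W = seminorm_on_subspace[OF N] and W' = seminorm_on_subspace[OF N']
  \<comment> \<open>A linear projection \<open>P\<close> onto \<open>W\<close>, found as a left
    inverse of the identity on \<open>W\<close>. Composing \<open>N\<close> with \<open>P\<close>
    gives a sublinear functional on the whole ambient space, as \<open>hahn_banach\<close>
    requires.\<close>
  have "\<exists>g. range g \<subseteq> W \<and> linear g \<and> (\<forall>v\<in>W. g (id v) = v)"
    by (rule linear_exists_left_inverse_on) (auto simp: W id_def linear_ident)
  then obtain P where P: "range P \<subseteq> W" "linear P" "\<And>v. v \<in> W \<Longrightarrow> P v = v" by auto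
  define Y where "Y = {y \<in> W. T y \<in> W'}"
  have Y: "subspace Y"
    using W W' by (auto simp: Y_def subspace_def linear_add[OF T] linear_scale[OF T] linear_0[OF T])
  have \<psi>': "\<And>x y. x \<in> W' \<Longrightarrow> y \<in> W' \<Longrightarrow> \<psi> (x + y) = \<psi> x + \<psi> y"
      "\<And>c x. x \<in> W' \<Longrightarrow> \<psi> (c *\<^sub>R x) = c * \<psi> x" "\<And>x. x \<in> W' \<Longrightarrow> \<bar>\<psi> x\<bar> \<le> N' x"
    using \<psi> by (auto simp: mem_dual_ball_iff[OF N'])
  have PW: "P x \<in> W" for x using P(1) by (simp add: image_subset_iff)
  have "sublinear (\<lambda>x. N (P x))"
  proof (rule sublinearI)
    show "N (P (x + y)) \<le> N (P x) + N (P y)" for x y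
      using N PW by (simp add: seminorm_on_def linear_add[OF P(2)])
    show "N (P (c *\<^sub>R x)) \<le> c * N (P x)" if "c > 0" for c x
      using seminorm_on_scaleR[OF N PW, of c x] that by (simp add: linear_scale[OF P(2)])
  qed (simp add: linear_0[OF P(2)] seminorm_on_0[OF N])
  from this Y obtain m where m: "linear m" "\<And>x. m x \<le> N (P x)" "\<And>y. y \<in> Y \<Longrightarrow> m y = \<psi> (T y)"
  proof (rule hahn_banach[where l = "\<lambda>y. \<psi> (T y)"])
    show "\<psi> (T (x + y)) = \<psi> (T x) + \<psi> (T y)" if "x \<in> Y" "y \<in> Y" for x y
      using that \<psi>' by (simp add: Y_def linear_add[OF T])
    show "\<psi> (T (c *\<^sub>R x)) = c * \<psi> (T x)" if "x \<in> Y" for c x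
      using that \<psi>' by (simp add: Y_def linear_scale[OF T])
    show "\<psi> (T y) \<le> N (P y)" if "y \<in> Y" for y
      using that \<psi>'(3)[of "T y"] contr[of y] P(3)[of y] by (simp add: Y_def)
  qed (rule that)
  define \<Psi> where "\<Psi> = (\<lambda>x. if x \<in> W then m x else 0)"
  have "\<bar>m x\<bar> \<le> N x" if "x \<in> W" for x
    using m(2)[of x] m(2)[of "- x"] P(3)[OF that] P(3)[of "- x"] subspace_neg[OF W that]
      seminorm_on_scaleR[OF N that, of "- 1"] linear_neg[OF m(1), of x] by simp
  then have mem: "\<Psi> \<in> dual_ball W N"
    using W by (auto simp: mem_dual_ball_iff[OF N] \<Psi>_def linear_add[OF m(1)] linear_scale[OF m(1)] subspace_add subspace_scale)
  have eq: "\<Psi> c = \<psi> (T c)" if "c \<in> W" "T c \<in> W'" for c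
    using m(3)[of c] that by (simp add: \<Psi>_def Y_def)
  show ?thesis using mem eq by (intro bexI[of _ \<Psi>]) simp_all
qed

text \<open>In terms of complements, this is a minimal closed set meeting every \<open>S i\<close>.
  Zorn's lemma applies by compactness: an \<open>S i\<close> covered by the union of a chain is
  covered by finitely many members, hence by the largest of them.\<close>

lemma ex_maximal_open_not_covering:
  assumes cpt: "\<And>i. i \<in> I \<Longrightarrow> compact (S i)" and ne: "\<And>i. i \<in> I \<Longrightarrow> S i \<noteq> {}"
  shows "\<exists>U. open U \<and> (\<forall>i\<in>I. \<not> S i \<subseteq> U) \<and> (\<forall>V. open V \<longrightarrow> U \<subset> V \<longrightarrow> (\<exists>i\<in>I. S i \<subseteq> V))"
proof -
  define \<A> where "\<A> = {U. open U \<and> (\<forall>i\<in>I. \<not> S i \<subseteq> U)}"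
  have "\<exists>M\<in>\<A>. \<forall>X\<in>\<A>. M \<subseteq> X \<longrightarrow> X = M"
  proof (rule subset_Zorn_nonempty)
    show "\<A> \<noteq> {}" using ne by (auto simp: \<A>_def intro!: exI[of _ "{}"])
    fix \<C> assume \<C>: "\<C> \<noteq> {}" "subset.chain \<A> \<C>"
    have sub: "\<C> \<subseteq> \<A>" using \<C>(2) by (simp add: subset_chain_def)
    have "\<not> S i \<subseteq> \<Union> \<C>" if i: "i \<in> I" for i
    proof
      assume "S i \<subseteq> \<Union> \<C>"
      then obtain \<D> where \<D>: "\<D> \<subseteq> \<C>" "finite \<D>" "S i \<subseteq> \<Union> \<D>"
        using compactE[OF cpt[OF i], of \<C>] sub by (auto simp: \<A>_def)
      \<comment> \<open>Nonemptiness of \<open>S i\<close> excludes the empty subcover, so the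
        finite chain has a largest member.\<close>
      have "\<D> \<noteq> {}" using \<D>(3) ne[OF i] by auto
      moreover have "subset.chain \<A> \<D>"
        using \<C>(2) \<D>(1) unfolding subset_chain_def by (meson order_trans subsetD)
      ultimately have "\<Union> \<D> \<in> \<A>"
        using Union_in_chain[OF \<D>(2)] \<D>(1) sub by (meson subsetD)
      then show False using \<D>(3) i unfolding \<A>_def by blast
    qed
    moreover have "open (\<Union> \<C>)" using sub unfolding \<A>_def by blast
    ultimately show "\<Union> \<C> \<in> \<A>" unfolding \<A>_def by blast
  qed
  then obtain U where U: "U \<in> \<A>" and max: "\<And>X. X \<in> \<A> \<Longrightarrow> U \<subseteq> X \<Longrightarrow> X = U" by blast
  show ?thesis
  proof (intro exI[of _ U] conjI allI impI)
    show "open U" "\<forall>i\<in>I. \<not> S i \<subseteq> U" using U by (auto simp: \<A>_def)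
    show "\<exists>i\<in>I. S i \<subseteq> V" if "open V" "U \<subset> V" for V
      using max[of V] that unfolding \<A>_def by blast
  qed
qed

(* The complement M of U in the dual ball of W is a minimal weak-star compact set containing a
   lift of every functional in A; minimality turns a weak-star open slice of M into one of A. *)
theorem asplund_subset_contraction_image:
  assumes N: "seminorm_on W N" and N': "seminorm_on W' N'" and T: "linear T"
    and contr: "\<And>y. y \<in> W \<Longrightarrow> T y \<in> W' \<Longrightarrow> N' (T y) \<le> N y"
    and TC: "T ` C \<subseteq> W'" and C: "asplund_subset W N C"
  shows "asplund_subset W' N' (T ` C)"
  unfolding asplund_subset_def
proof (intro conjI allI impI)
  have CW: "C \<subseteq> W" using C by (simp add: asplund_subset_def bounded_subset_def)
  obtain K where K: "\<And>c. c \<in> C \<Longrightarrow> N c \<le> K" using C unfolding asplund_subset_def bounded_subset_def by blast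
  have "N' (T c) \<le> K" if "c \<in> C" for c
    using contr[of c] K[OF that] CW TC that by force
  then show "bounded_subset W' N' (T ` C)" using TC unfolding bounded_subset_def by blast
  fix A :: "('b \<Rightarrow> real) set" and \<epsilon> :: real
  assume A: "A \<subseteq> dual_ball W' N' \<and> A \<noteq> {} \<and> \<epsilon> > 0"
  define B where "B = dual_ball W N"
  \<comment> \<open>\<open>F\<close> and \<open>E\<close> record values on \<open>C\<close> only,
    for \<psi> composed with \<open>T\<close> and for \<Psi> respectively. A lift of \<psi> is an
    element of the ball with the same record; this is all that the diameters see, and it makes the
    set \<open>S \<psi>\<close> of lifts closed.\<close>
  define F where "F = (\<lambda>\<psi> :: 'b \<Rightarrow> real. \<lambda>c. if c \<in> C then \<psi> (T c) else 0)"
  define E where "E = (\<lambda>\<Psi> :: 'a \<Rightarrow> real. \<lambda>c. if c \<in> C then \<Psi> c else 0)"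
  define S where "S \<psi> = {\<Psi> \<in> B. E \<Psi> = F \<psi>}" for \<psi>
  have cptB: "compact B" unfolding B_def by (rule compact_dual_ball[OF N])
  have contE_coord: "continuous_on UNIV (\<lambda>\<Psi>. E \<Psi> c)" for c
    unfolding E_def by (cases "c \<in> C") (auto intro: continuous_intros)
  then have contE: "continuous_on X E" for X
    by (rule continuous_on_subset[OF continuous_on_coordinatewise_then_product]) simp
  from contE_coord have "closed {\<Psi>. \<forall>c. E \<Psi> c = F \<psi> c}" for \<psi>
    by (intro closed_Collect_all closed_Collect_eq continuous_on_const)
  moreover have "S \<psi> = B \<inter> {\<Psi>. \<forall>c. E \<Psi> c = F \<psi> c}" for \<psi>
    by (auto simp: S_def fun_eq_iff)
  ultimately have "compact (S \<psi>)" for \<psi>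
    using cptB by (simp add: compact_Int_closed)
  moreover have "S \<psi> \<noteq> {}" if "\<psi> \<in> A" for \<psi>
  proof -
    have "\<psi> \<in> dual_ball W' N'" using A that by blast
    from dual_ball_lift[OF N N' T contr this] obtain \<Psi> where
      "\<Psi> \<in> dual_ball W N" "\<forall>c\<in>W. T c \<in> W' \<longrightarrow> \<Psi> c = \<psi> (T c)" ..
    then have "\<Psi> \<in> S \<psi>" using CW TC by (auto simp: S_def B_def E_def F_def fun_eq_iff)
    then show ?thesis by blast
  qed
  ultimately obtain U where U: "open U" "\<forall>\<psi>\<in>A. \<not> S \<psi> \<subseteq> U"
    "\<forall>V. open V \<longrightarrow> U \<subset> V \<longrightarrow> (\<exists>\<psi>\<in>A. S \<psi> \<subseteq> V)"
    using ex_maximal_open_not_covering[of A S] by auto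
  define M where "M = B - U"
  have "M \<noteq> {}" using A U(2) by (auto simp: M_def S_def)
  moreover have "M \<subseteq> dual_ball W N" by (auto simp: M_def B_def)
  \<comment> \<open>Fragmentability of \<open>C\<close>, applied to the minimal set
    \<open>M\<close>, yields a slice of \<open>M\<close> with small diameters.\<close>
  ultimately obtain O' where O': "openin (weak_star W N) O'" "O' \<inter> M \<noteq> {}"
      and diam: "\<And>c. c \<in> C \<Longrightarrow> diameter ((\<lambda>\<psi>. \<psi> c) ` (O' \<inter> M)) < \<epsilon>"
    using C A unfolding asplund_subset_def by meson
  obtain G where G: "open G" "dual_space W N \<inter> O' = dual_space W N \<inter> G"
    using openin_weak_star_restrict[OF O'(1)] by blast
  then have OG: "\<Psi> \<in> O' \<longleftrightarrow> \<Psi> \<in> G" if "\<Psi> \<in> B" for \<Psi>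
    using that by (auto simp: B_def dual_ball_def)
  \<comment> \<open>The slice contains a point of \<open>G\<close> outside \<open>U\<close>. By
    maximality of \<open>U\<close>, the larger open set contains all lifts of some functional
    \<open>\<psi>\<^sub>0\<close> in \<open>A\<close>.\<close>
  then have "U \<subset> G \<union> U" using O'(2) by (auto simp: M_def)
  then obtain \<psi>\<^sub>0 where \<psi>0: "\<psi>\<^sub>0 \<in> A" "S \<psi>\<^sub>0 \<subseteq> G \<union> U"
    using U(1) U(3)[rule_format, of "G \<union> U"] G(1) by auto
  \<comment> \<open>\<open>Z\<close> is the set of records of ball elements outside
    \<open>G \<union> U\<close>; it is closed as a continuous image of a compact set. If
    \<open>F \<psi>\<close> avoids \<open>Z\<close>, then every lift of \<psi> lies in
    \<open>G \<union> U\<close>. Pulling back the complement of \<open>Z\<close> along the weak-star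
    continuous map \<open>F\<close> gives the open set \<open>Q\<close>.\<close>
  define Z where "Z = E ` (B - (G \<union> U))"
  have "compact (B - (G \<union> U))" using cptB G(1) U(1) by (intro compact_diff) auto
  then have "closed Z"
    unfolding Z_def by (intro compact_imp_closed_fun compact_continuous_image contE)
  define Q where "Q = {\<psi> \<in> topspace (weak_star W' N'). F \<psi> \<in> - Z}"
  have "continuous_map (weak_star W' N') euclidean (\<lambda>\<psi>. F \<psi> c)" for c
    unfolding F_def using TC continuous_map_weak_star[of "T c" W' N'] by (cases "c \<in> C") auto
  then have "continuous_map (weak_star W' N') (product_topology (\<lambda>_. euclidean) UNIV) F"
    by (simp add: continuous_map_componentwise_UNIV)
  then have "continuous_map (weak_star W' N') euclidean F"
    by (simp add: euclidean_product_topology)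
  then have Q: "openin (weak_star W' N') Q"
    unfolding Q_def using \<open>closed Z\<close> by (intro openin_continuous_map_preimage) auto
  have "F \<psi>\<^sub>0 \<notin> Z" using \<psi>0(2) by (auto simp: Z_def S_def)
  moreover have "\<psi>\<^sub>0 \<in> topspace (weak_star W' N')"
  proof -
    have "W' \<noteq> {}" using subspace_0[OF seminorm_on_subspace[OF N']] by blast
    then show ?thesis using A \<psi>0(1) by (auto simp: topspace_weak_star dual_ball_def)
  qed
  ultimately have ne: "Q \<inter> A \<noteq> {}" using \<psi>0(1) by (auto simp: Q_def)
  \<comment> \<open>By the choice of \<open>U\<close>, some lift of \<psi> lies outside
    \<open>U\<close>; since \<open>F \<psi>\<close> avoids \<open>Z\<close>, this lift lies in
    \<open>G\<close>, hence in the small slice of \<open>M\<close>.\<close>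
  have lift: "\<exists>\<Psi>\<in>O' \<inter> M. E \<Psi> = F \<psi>" if "\<psi> \<in> Q \<inter> A" for \<psi>
  proof -
    have "\<not> S \<psi> \<subseteq> U" using U(2) that by simp
    then obtain \<Psi> where \<Psi>: "\<Psi> \<in> S \<psi>" "\<Psi> \<notin> U" by auto
    then have B: "\<Psi> \<in> B" and eq: "E \<Psi> = F \<psi>" by (auto simp: S_def)
    have "F \<psi> \<notin> Z" using that by (simp add: Q_def)
    then have "\<Psi> \<notin> B - (G \<union> U)" using eq by (metis Z_def imageI)
    then show ?thesis using \<Psi>(2) B OG[OF B] eq by (intro bexI[of _ \<Psi>]) (auto simp: M_def)
  qed
  have "diameter ((\<lambda>\<psi>. \<psi> c) ` (Q \<inter> A)) < \<epsilon>" if "c \<in> T ` C" for c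
  proof -
    from \<open>c \<in> T ` C\<close> obtain d where d: "c = T d" "d \<in> C" by (rule imageE)
    have "(\<lambda>\<psi>. \<psi> c) ` (Q \<inter> A) \<subseteq> (\<lambda>\<psi>. \<psi> d) ` (O' \<inter> M)"
    proof (clarify)
      fix \<psi> assume "\<psi> \<in> Q" "\<psi> \<in> A"
      then have "\<exists>\<Psi>\<in>O' \<inter> M. E \<Psi> = F \<psi>" by (intro lift) simp
      then obtain \<Psi> where \<Psi>: "\<Psi> \<in> O' \<inter> M" and eq: "E \<Psi> = F \<psi>" ..
      have "\<psi> c = \<Psi> d"
        using fun_cong[OF eq, of d] d by (simp add: E_def F_def)
      then show "\<psi> c \<in> (\<lambda>\<psi>. \<psi> d) ` (O' \<inter> M)" using \<Psi> by (rule image_eqI)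
    qed
    \<comment> \<open>Monotonicity of \<open>diameter\<close> requires the larger set to be bounded;
      on the dual ball, evaluation at \<open>d\<close> is bounded by \<open>N d\<close>.\<close>
    moreover have "bounded ((\<lambda>\<psi>. \<psi> d) ` (O' \<inter> M))"
      using CW d(2) by (auto simp: bounded_iff M_def B_def mem_dual_ball_iff[OF N] intro!: exI[of _ "N d"])
    ultimately show ?thesis using diam[OF d(2)] by (meson diameter_subset order_le_less_trans)
  qed
  then show "\<exists>O'. openin (weak_star W' N') O' \<and> O' \<inter> A \<noteq> {} \<and> (\<forall>c\<in>T ` C. diameter ((\<lambda>\<psi>. \<psi> c) ` (O' \<inter> A)) < \<epsilon>)"
    using Q ne by (intro exI[of _ Q]) simp
qed

text \<open>An l^1-sequence in the image lifts: choose preimages in \<open>C\<close>. Their upper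
  bound comes from boundedness of \<open>C\<close>, and their lower l^1-estimate from that of the
  images, since \<open>T\<close> cannot increase the norm of a linear combination.\<close>

theorem tame_subset_contraction_image:
  assumes W: "subspace W" and W': "subspace W'" and T: "linear T"
    and contr: "\<And>y. y \<in> W \<Longrightarrow> T y \<in> W' \<Longrightarrow> N' (T y) \<le> N y"
    and TC: "T ` C \<subseteq> W'" and C: "tame_subset W N C"
  shows "tame_subset W' N' (T ` C)"
  unfolding tame_subset_def
proof
  have CW: "C \<subseteq> W" using C by (simp add: tame_subset_def bounded_subset_def)
  obtain K where K: "\<And>c. c \<in> C \<Longrightarrow> N c \<le> K" using C by (auto simp: tame_subset_def bounded_subset_def)
  have "N' (T c) \<le> K" if "c \<in> C" for c
    using contr[of c] K[OF that] CW TC that by force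
  then show "bounded_subset W' N' (T ` C)" using TC unfolding bounded_subset_def by blast
  show "\<not> (\<exists>s. range s \<subseteq> T ` C \<and> l1_sequence N' s)"
  proof
    assume "\<exists>s. range s \<subseteq> T ` C \<and> l1_sequence N' s"
    then obtain s where s: "range s \<subseteq> T ` C" and "l1_sequence N' s" by auto
    then obtain \<delta> where \<delta>: "\<delta> > 0"
      "\<forall>n c. \<delta> * (\<Sum>i<n. \<bar>c i\<bar>) \<le> N' (\<Sum>i<n. c i *\<^sub>R s i)"
      unfolding l1_sequence_def by auto
    have "\<exists>t. t \<in> C \<and> s n = T t" for n
      using s by (simp add: image_subset_iff image_iff) blast
    then obtain t where t: "\<And>n. t n \<in> C" "\<And>n. s n = T (t n)" by metis
    have "\<delta> * (\<Sum>i<n. \<bar>c i\<bar>) \<le> N (\<Sum>i<n. c i *\<^sub>R t i)" for n c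
    proof -
      have eq: "T (\<Sum>i<n. c i *\<^sub>R t i) = (\<Sum>i<n. c i *\<^sub>R s i)"
        by (simp add: linear_sum[OF T] linear_scale[OF T] t)
      have "s i \<in> W'" for i using t TC by (simp add: image_subset_iff)
      then have "(\<Sum>i<n. c i *\<^sub>R s i) \<in> W'" using W' by (intro subspace_sum subspace_scale)
      moreover have "(\<Sum>i<n. c i *\<^sub>R t i) \<in> W"
        using W CW t(1) by (intro subspace_sum subspace_scale) auto
      ultimately have "N' (\<Sum>i<n. c i *\<^sub>R s i) \<le> N (\<Sum>i<n. c i *\<^sub>R t i)"
        using contr[of "\<Sum>i<n. c i *\<^sub>R t i"] eq by simp
      then show ?thesis using \<delta>(2)[rule_format, of c n] by simp
    qed
    then have "\<exists>\<delta>>0. \<forall>n c. \<delta> * (\<Sum>i<n. \<bar>c i\<bar>) \<le> N (\<Sum>i<n. c i *\<^sub>R t i)"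
      using \<delta>(1) by (intro exI[of _ \<delta>]) simp
    moreover have "\<exists>K. \<forall>n. N (t n) \<le> K" using K t(1) by (intro exI[of _ K]) simp
    ultimately have "l1_sequence N t" by (simp add: l1_sequence_def)
    moreover have "range t \<subseteq> C" using t(1) by (simp add: image_subset_iff)
    ultimately show False using C by (simp add: tame_subset_def)
  qed
qed

section \<open>Passage to subsets\<close>

lemma subset_bounded: "bounded_subset W N C \<Longrightarrow> D \<subseteq> C \<Longrightarrow> bounded_subset W N D"
  unfolding bounded_subset_def by (meson order_trans subsetD)

lemma subset_tame:
  assumes C: "tame_subset W N C" and D: "D \<subseteq> C"
  shows "tame_subset W N D"
  unfolding tame_subset_def
proof (intro conjI notI)
  show "bounded_subset W N D" using C subset_bounded[OF _ D] by (simp add: tame_subset_def)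
  assume "\<exists>s. range s \<subseteq> D \<and> l1_sequence N s"
  then obtain s where "range s \<subseteq> D" "l1_sequence N s" by auto
  then show False using C subset_trans[OF _ D] by (simp add: tame_subset_def)
qed

lemma subset_asplund:
  assumes C: "asplund_subset W N C" and D: "D \<subseteq> C"
  shows "asplund_subset W N D"
  unfolding asplund_subset_def
proof (intro conjI allI impI)
  show "bounded_subset W N D"
    using C subset_bounded[OF _ D] by (simp add: asplund_subset_def)
  fix A and \<epsilon> :: real assume "A \<subseteq> dual_ball W N \<and> A \<noteq> {} \<and> \<epsilon> > 0"
  then obtain O' where "openin (weak_star W N) O'" "O' \<inter> A \<noteq> {}"
      "\<forall>c\<in>C. diameter ((\<lambda>\<psi>. \<psi> c) ` (O' \<inter> A)) < \<epsilon>"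
    using C unfolding asplund_subset_def by meson
  then show "\<exists>O'. openin (weak_star W N) O' \<and> O' \<inter> A \<noteq> {} \<and> (\<forall>c\<in>D. diameter ((\<lambda>\<psi>. \<psi> c) ` (O' \<inter> A)) < \<epsilon>)"
    using D by blast
qed

section \<open>Matrix coefficients\<close>

lemma abs_le_sup_norm: "f \<in> RUCb \<Longrightarrow> \<bar>f g\<bar> \<le> sup_norm f"
proof -
  assume "f \<in> RUCb"
  then have "bounded (range f)" by (simp add: RUCb_def)
  then have "bdd_above (range (\<lambda>g. \<bar>f g\<bar>))" by (auto simp: bounded_iff bdd_above_def)
  then show ?thesis unfolding sup_norm_def by (rule cSUP_upper2) auto
qed

lemma sup_norm_le: "(\<And>g. \<bar>f g\<bar> \<le> K) \<Longrightarrow> sup_norm f \<le> K"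
  unfolding sup_norm_def by (rule cSUP_least) auto

lemma seminorm_on_RUCb: "seminorm_on (RUCb :: ('g::topological_group_add \<Rightarrow> real) set) sup_norm"
proof -
  have add: "f + h \<in> RUCb" if f: "f \<in> RUCb" and h: "h \<in> RUCb" for f h :: "'g \<Rightarrow> real"
    unfolding RUCb_def
  proof (intro CollectI conjI allI impI)
    have "\<bar>(f + h) g\<bar> \<le> sup_norm f + sup_norm h" for g
      using abs_le_sup_norm[OF f, of g] abs_le_sup_norm[OF h, of g] by simp
    then show "bounded (range (f + h))" by (auto simp: bounded_iff)
    fix \<epsilon> :: real assume "\<epsilon> > 0"
    then have "\<epsilon> / 2 > 0" by simp
    then obtain U V where "open U" "0 \<in> U" and U: "\<And>g k. g - k \<in> U \<Longrightarrow> \<bar>f g - f k\<bar> < \<epsilon> / 2"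
      and "open V" "0 \<in> V" and V: "\<And>g k. g - k \<in> V \<Longrightarrow> \<bar>h g - h k\<bar> < \<epsilon> / 2"
      using f h unfolding RUCb_def by blast
    moreover have "\<bar>(f + h) g - (f + h) k\<bar> < \<epsilon>" if "g - k \<in> U \<inter> V" for g k
    proof -
      have "\<bar>f g - f k\<bar> < \<epsilon> / 2" "\<bar>h g - h k\<bar> < \<epsilon> / 2" using U V that by auto
      then show ?thesis unfolding plus_fun_apply by linarith
    qed
    ultimately show "\<exists>U. open U \<and> 0 \<in> U \<and> (\<forall>g k. g - k \<in> U \<longrightarrow> \<bar>(f + h) g - (f + h) k\<bar> < \<epsilon>)"
      by (intro exI[of _ "U \<inter> V"]) auto
  qed
  have scale: "c *\<^sub>R f \<in> RUCb" if f: "f \<in> RUCb" for c and f :: "'g \<Rightarrow> real"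
    unfolding RUCb_def
  proof (intro CollectI conjI allI impI)
    have "\<bar>(c *\<^sub>R f) g\<bar> \<le> \<bar>c\<bar> * sup_norm f" for g
      using mult_left_mono[OF abs_le_sup_norm[OF f, of g], of "\<bar>c\<bar>"] by (simp add: scaleR_fun_def abs_mult)
    then show "bounded (range (c *\<^sub>R f))" by (auto simp: bounded_iff)
    fix \<epsilon> :: real assume "\<epsilon> > 0"
    \<comment> \<open>The summand 1 keeps the denominator positive when \<open>c = 0\<close> and
      supplies the strict inequality at the end.\<close>
    then have pos: "\<epsilon> / (\<bar>c\<bar> + 1) > 0" by simp
    then obtain U where "open U" "0 \<in> U" and U: "\<And>g k. g - k \<in> U \<Longrightarrow> \<bar>f g - f k\<bar> < \<epsilon> / (\<bar>c\<bar> + 1)"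
      using f unfolding RUCb_def by blast
    moreover have "\<bar>(c *\<^sub>R f) g - (c *\<^sub>R f) k\<bar> < \<epsilon>" if "g - k \<in> U" for g k
    proof -
      have "\<bar>(c *\<^sub>R f) g - (c *\<^sub>R f) k\<bar> = \<bar>c\<bar> * \<bar>f g - f k\<bar>"
        by (simp add: scaleR_fun_def abs_mult right_diff_distrib[symmetric])
      also have "\<dots> \<le> \<bar>c\<bar> * (\<epsilon> / (\<bar>c\<bar> + 1))" using U[OF that] by (intro mult_left_mono) auto
      also have "\<dots> < (\<bar>c\<bar> + 1) * (\<epsilon> / (\<bar>c\<bar> + 1))" using pos by (intro mult_strict_right_mono) auto
      finally show ?thesis by simp
    qed
    ultimately show "\<exists>U. open U \<and> 0 \<in> U \<and> (\<forall>g k. g - k \<in> U \<longrightarrow> \<bar>(c *\<^sub>R f) g - (c *\<^sub>R f) k\<bar> < \<epsilon>)"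
      by blast
  qed
  have "0 \<in> (RUCb :: ('g \<Rightarrow> real) set)" by (auto simp: RUCb_def intro!: exI[of _ UNIV])
  then have sub: "subspace (RUCb :: ('g \<Rightarrow> real) set)" using add scale by (simp add: subspace_def)
  have tri: "sup_norm (f + h) \<le> sup_norm f + sup_norm h" if "f \<in> RUCb" "h \<in> RUCb" for f h :: "'g \<Rightarrow> real"
  proof (rule sup_norm_le)
    show "\<bar>(f + h) g\<bar> \<le> sup_norm f + sup_norm h" for g
      using abs_le_sup_norm[OF that(1), of g] abs_le_sup_norm[OF that(2), of g] by simp
  qed
  have "sup_norm (c *\<^sub>R f) = \<bar>c\<bar> * sup_norm f" if "f \<in> RUCb" for c and f :: "'g \<Rightarrow> real"
  proof (rule antisym)
    show "sup_norm (c *\<^sub>R f) \<le> \<bar>c\<bar> * sup_norm f"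
      using abs_le_sup_norm[OF that] by (intro sup_norm_le) (simp add: scaleR_fun_def abs_mult mult_left_mono)
    show "\<bar>c\<bar> * sup_norm f \<le> sup_norm (c *\<^sub>R f)"
    proof (cases "c = 0")
      case True
      then show ?thesis using abs_le_sup_norm[OF scale[OF that], of c 0] by simp
    next
      case False
      have "sup_norm f \<le> sup_norm (c *\<^sub>R f) / \<bar>c\<bar>"
        using abs_le_sup_norm[OF scale[OF that], of c] False
        by (intro sup_norm_le) (simp add: scaleR_fun_def abs_mult field_simps)
      then show ?thesis using False by (simp add: field_simps)
    qed
  qed
  then show ?thesis using sub tri by (simp add: seminorm_on_def)
qed

section \<open>The closed span of the representation\<close>

lemma seminorm_on_norm: "subspace W \<Longrightarrow> seminorm_on W norm"
  by (simp add: seminorm_on_def norm_triangle_ineq)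

lemma subspace_closure:
  fixes S :: "'a::real_normed_vector set"
  assumes S: "subspace S"
  shows "subspace (closure S)"
  unfolding subspace_def
proof (intro conjI ballI allI)
  show "0 \<in> closure S" using subspace_0[OF S] closure_subset[of S] by (rule subsetD[rotated])
  show "x + y \<in> closure S" if "x \<in> closure S" "y \<in> closure S" for x y
  proof -
    from that obtain f h where f: "\<forall>n. f n \<in> S" "f \<longlonglongrightarrow> x" and h: "\<forall>n. h n \<in> S" "h \<longlonglongrightarrow> y"
      unfolding closure_sequential by auto
    have "\<forall>n. f n + h n \<in> S" using f(1) h(1) subspace_add[OF S] by simp
    then show ?thesis using tendsto_add[OF f(2) h(2)] unfolding closure_sequential by auto
  qed
  show "c *\<^sub>R x \<in> closure S" if "x \<in> closure S" for c x
  proof -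
    from that obtain f where f: "\<forall>n. f n \<in> S" "f \<longlonglongrightarrow> x"
      unfolding closure_sequential by auto
    have "\<forall>n. c *\<^sub>R f n \<in> S" using f(1) subspace_scale[OF S] by simp
    then show ?thesis using tendsto_scaleR[OF tendsto_const[of c] f(2)] unfolding closure_sequential by auto
  qed
qed

lemma rep_mem_rep_algebra: "\<alpha> g \<in> rep_algebra \<alpha>"
  unfolding rep_algebra_def by (rule subsetD[OF closure_subset span_base[OF rangeI]])

text \<open>The operators \<open>\<alpha> g\<close> belong to the algebra, so the zero branch of
  \<open>matrix_functional\<close> is never reached.\<close>

lemma matrix_coefficient_eq: "matrix_coefficient \<alpha> x \<phi> g = blinfun_apply \<phi> (blinfun_apply (\<alpha> g) x)"
  by (simp add: matrix_coefficient_def matrix_functional_def rep_mem_rep_algebra)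

lemma strongly_continuous_rep_norm:
  "strongly_continuous_rep \<alpha> \<Longrightarrow> norm (blinfun_apply (\<alpha> g) x) = norm x"
  by (auto simp: strongly_continuous_rep_def Iso_def)

lemma strongly_continuous_rep_add:
  "strongly_continuous_rep \<alpha> \<Longrightarrow> \<alpha> (g + h) = \<alpha> h o\<^sub>L \<alpha> g"
  by (simp add: strongly_continuous_rep_def)

lemma strongly_continuous_rep_norm_le:
  "strongly_continuous_rep \<alpha> \<Longrightarrow> norm (\<alpha> g) \<le> 1"
  by (rule norm_blinfun_bound) (simp_all add: strongly_continuous_rep_norm)

text \<open>From \<open>0 + 0 = 0\<close> the operator \<open>\<alpha> 0\<close> is idempotent; an
  idempotent isometry is the identity, because it is injective and kills every
  \<open>\<alpha> 0 x - x\<close>.\<close>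

lemma strongly_continuous_rep_0:
  assumes "strongly_continuous_rep \<alpha>"
  shows "blinfun_apply (\<alpha> 0) x = x"
proof -
  have "blinfun_apply (\<alpha> 0) (blinfun_apply (\<alpha> 0) x) = blinfun_apply (\<alpha> 0) x"
    using arg_cong[OF strongly_continuous_rep_add[OF assms, of 0 0], of "\<lambda>T. blinfun_apply T x"] by simp
  then have "blinfun_apply (\<alpha> 0) (blinfun_apply (\<alpha> 0) x - x) = 0"
    by (simp add: blinfun.diff_right)
  then show ?thesis
    using strongly_continuous_rep_norm[OF assms, of 0 "blinfun_apply (\<alpha> 0) x - x"] by simp
qed

lemma abs_matrix_coefficient_le:
  assumes "strongly_continuous_rep \<alpha>"
  shows "\<bar>matrix_coefficient \<alpha> x \<phi> g\<bar> \<le> norm \<phi> * norm x"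
  using norm_blinfun[of \<phi> "blinfun_apply (\<alpha> g) x"]
  by (simp add: matrix_coefficient_eq strongly_continuous_rep_norm[OF assms])

text \<open>Writing \<open>g = (g - h) + h\<close>, the reversed product rule puts the isometry
  \<open>\<alpha> h\<close> outermost, where it leaves the norm of
  \<open>\<alpha> (g - h) x - x\<close> unchanged. Continuity of the single orbit map of
  \<open>x\<close> therefore controls all pairs uniformly.\<close>

lemma matrix_coefficient_RUCb:
  assumes \<alpha>: "strongly_continuous_rep \<alpha>"
  shows "matrix_coefficient \<alpha> x \<phi> \<in> RUCb"
  unfolding RUCb_def
proof (intro CollectI conjI allI impI)
  show "bounded (range (matrix_coefficient \<alpha> x \<phi>))"
    using abs_matrix_coefficient_le[OF \<alpha>] by (auto simp: bounded_iff)
  fix \<epsilon> :: real assume \<epsilon>: "\<epsilon> > 0"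
  \<comment> \<open>Keeping \<open>norm \<phi>\<close> as a factor instead of dividing by it covers
    \<phi> = 0 as well.\<close>
  define U where "U = {u. norm \<phi> * norm (blinfun_apply (\<alpha> u) x - x) < \<epsilon>}"
  have "continuous_on UNIV (\<lambda>u. blinfun_apply (\<alpha> u) x)"
    using \<alpha> by (simp add: strongly_continuous_rep_def)
  then have "open U" unfolding U_def
    by (intro open_Collect_less continuous_on_mult continuous_on_norm continuous_on_diff continuous_on_const)
  moreover have "0 \<in> U" using \<epsilon> by (simp add: U_def strongly_continuous_rep_0[OF \<alpha>])
  moreover have "\<bar>matrix_coefficient \<alpha> x \<phi> g - matrix_coefficient \<alpha> x \<phi> h\<bar> < \<epsilon>" if "g - h \<in> U" for g h
  proof -
    have "\<alpha> g = \<alpha> h o\<^sub>L \<alpha> (g - h)"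
      using strongly_continuous_rep_add[OF \<alpha>, of "g - h" h] by simp
    then have "matrix_coefficient \<alpha> x \<phi> g - matrix_coefficient \<alpha> x \<phi> h
        = blinfun_apply \<phi> (blinfun_apply (\<alpha> h) (blinfun_apply (\<alpha> (g - h)) x - x))"
      by (simp add: matrix_coefficient_eq blinfun.diff_right)
    also have "\<bar>\<dots>\<bar> \<le> norm \<phi> * norm (blinfun_apply (\<alpha> (g - h)) x - x)"
      using norm_blinfun[of \<phi> "blinfun_apply (\<alpha> h) (blinfun_apply (\<alpha> (g - h)) x - x)"]
      by (simp add: strongly_continuous_rep_norm[OF \<alpha>])
    finally show ?thesis using that by (simp add: U_def)
  qed
  ultimately show "\<exists>U. open U \<and> 0 \<in> U \<and> (\<forall>g h. g - h \<in> U \<longrightarrow>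
      \<bar>matrix_coefficient \<alpha> x \<phi> g - matrix_coefficient \<alpha> x \<phi> h\<bar> < \<epsilon>)" by blast
qed

text \<open>The co-homomorphism rule turns translation of the coefficient into motion of the vector;
  hence all translates are again matrix coefficients and lie in \<open>RUCb\<close>.\<close>

lemma translate_matrix_coefficient:
  assumes "strongly_continuous_rep \<alpha>"
  shows "translate (matrix_coefficient \<alpha> x \<phi>) g = matrix_coefficient \<alpha> (blinfun_apply (\<alpha> g) x) \<phi>"
  by (simp add: fun_eq_iff translate_def matrix_coefficient_eq strongly_continuous_rep_add[OF assms])

text \<open>Both sides at \<open>h\<close> are \<phi> applied to
  \<open>\<alpha> h (\<alpha> g x)\<close>. The composite of \<open>\<alpha> h\<close> and
  \<open>\<alpha> g\<close> is \<open>\<alpha> (g + h)\<close>, so it stays in the algebra and the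
  extension by zero does not interfere.\<close>

lemma functional_act_rep:
  assumes "strongly_continuous_rep \<alpha>"
  shows "functional_act (rep_algebra \<alpha>) (\<alpha> g) (matrix_functional (rep_algebra \<alpha>) x \<phi>) \<circ> \<alpha>
     = translate (matrix_coefficient \<alpha> x \<phi>) g"
proof -
  have "\<alpha> h o\<^sub>L \<alpha> g \<in> rep_algebra \<alpha>" for h
    using rep_mem_rep_algebra[of \<alpha> "g + h"] by (simp add: strongly_continuous_rep_add[OF assms])
  then show ?thesis
    by (simp add: fun_eq_iff functional_act_def matrix_functional_def rep_mem_rep_algebra
        translate_matrix_coefficient[OF assms] matrix_coefficient_eq)
qed

theorem proposition5p9:
  fixes \<alpha> :: "'g::topological_group_add \<Rightarrow> ('v::banach \<Rightarrow>\<^sub>L 'v)"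
    and x :: 'v
    and \<phi> :: "'v \<Rightarrow>\<^sub>L real"
  assumes "strongly_continuous_rep \<alpha>"
  shows "(left_asplund (rep_algebra \<alpha>) (matrix_functional (rep_algebra \<alpha>) x \<phi>) \<longrightarrow>
            right_asplund (matrix_coefficient \<alpha> x \<phi>)) \<and>
         (left_tame (rep_algebra \<alpha>) (matrix_functional (rep_algebra \<alpha>) x \<phi>) \<longrightarrow>
            right_tame (matrix_coefficient \<alpha> x \<phi>))"
proof -
  let ?A = "rep_algebra \<alpha>" and ?\<Phi> = "matrix_functional (rep_algebra \<alpha>) x \<phi>"
  let ?W = "dual_space ?A norm" and ?N = "dual_norm ?A norm"
  define T where "T y = y \<circ> \<alpha>" for y :: "('v \<Rightarrow>\<^sub>L 'v) \<Rightarrow> real"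
  \<comment> \<open>The part of the ball orbit given by group elements, which lie in the unit ball
    as isometries. \<open>T\<close> maps it exactly onto the orbit of the matrix
    coefficient.\<close>
  define C where "C = range (\<lambda>g. functional_act ?A (\<alpha> g) ?\<Phi>)"
  have A: "seminorm_on ?A norm"
    unfolding rep_algebra_def by (intro seminorm_on_norm subspace_closure subspace_span)
  note N = seminorm_on_dual[OF A]
  have T: "linear T" by (rule linearI) (auto simp: T_def scaleR_fun_def)
  have contr: "sup_norm (T y) \<le> ?N y" if "y \<in> ?W" for y
  proof (rule sup_norm_le)
    fix g
    have "\<bar>y (\<alpha> g)\<bar> \<le> ?N y * norm (\<alpha> g)" by (rule abs_le_dual_norm[OF A that rep_mem_rep_algebra])
    also have "\<dots> \<le> ?N y"
      using strongly_continuous_rep_norm_le[OF assms] dual_norm_nonneg[OF A that] by (intro mult_left_le) auto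
    finally show "\<bar>T y g\<bar> \<le> ?N y" by (simp add: T_def)
  qed
  have TC: "T ` C = range (translate (matrix_coefficient \<alpha> x \<phi>))"
    unfolding C_def image_image T_def functional_act_rep[OF assms] ..
  then have TC': "T ` C \<subseteq> RUCb"
    by (auto simp: translate_matrix_coefficient[OF assms] matrix_coefficient_RUCb[OF assms])
  have C: "C \<subseteq> ball_orbit ?A ?\<Phi>"
    unfolding C_def
  proof (rule image_subsetI)
    show "functional_act ?A (\<alpha> g) ?\<Phi> \<in> ball_orbit ?A ?\<Phi>" for g
      unfolding ball_orbit_def
      using rep_mem_rep_algebra[of \<alpha> g] strongly_continuous_rep_norm_le[OF assms, of g]
      by (intro CollectI exI[of _ "\<alpha> g"]) simp
  qed
  have "asplund_subset RUCb sup_norm (T ` C)" if "asplund_subset ?W ?N (ball_orbit ?A ?\<Phi>)"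
    using asplund_subset_contraction_image[OF N seminorm_on_RUCb T contr TC' subset_asplund[OF that C]] .
  moreover have "tame_subset RUCb sup_norm (T ` C)" if "tame_subset ?W ?N (ball_orbit ?A ?\<Phi>)"
    using tame_subset_contraction_image[OF seminorm_on_subspace[OF N] seminorm_on_subspace[OF seminorm_on_RUCb]
        T contr TC' subset_tame[OF that C]] .
  ultimately show ?thesis
    unfolding left_asplund_def left_tame_def right_asplund_def right_tame_def TC
    by (simp add: matrix_coefficient_RUCb[OF assms])
qed

end
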